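(* Let $\gamma_t=(p_t,\tau_t^2,\sigma_t^2,\delta_{0t},\delta_{At})$, $t=1,2,\dots$, be a sequence of parameter vectors such that, with $u=\tau^2/\sigma^2$, $f=(1-p)/p$, $\delta=\delta_0/\delta_A$ and $v=uf^2\delta^2$ (index $t$ suppressed), one has as $t\to\infty$: $p\to 0$, $u\to\infty$, $v\to\infty$ and $\frac{\log v}{u}\to C\in(0,\infty)$. Consider the multiple testing rule which for each $i$ rejects $H_{0i}$ if and only if $X_i^2/\sigma^2\ge c_t^2$, and write $c_t^2=\log v+z_t$. Then this rule is ABOS if and only if both $$z_t=o(\log v)\qquad\text{and}\qquad z_t+2\log\log v\to\infty \quad (t\to\infty).$$
   Context: Model. Given a number of tests $m\ge 1$ and parameters $p\in(0,1)$, $\sigma^2>0$, $\tau^2>0$, let $(\nu_i,X_i)$, $i=1,\dots,m$, be i.i.d. with $P(\nu_i=1)=p=1-P(\nu_i=0)$, $X_i\mid\nu_i=0\sim N(0,\sigma^2)$ and $X_i\mid\nu_i=1\sim N(0,\sigma^2+\tau^2)$. Only the $X_i$ are observed. The null hypothesis $H_{0i}$ is the event $\nu_i=0$, the alternative $H_{Ai}$ is $\nu_i=1$. A type I error (rejecting a true $H_{0i}$) costs $\delta_0>0$, a type II error (accepting $H_{0i}$ when $H_{Ai}$ holds) costs $\delta_A>0$, and the total loss is the sum over the $m$ tests. The Bayes risk of a multiple testing rule is therefore $R=\delta_0E(V)+\delta_AE(T)$, where $V$ is the number of false rejections and $T$ the number of false acceptances; for a rule applying one fixed threshold in all tests, $R=m((1-p)t_1\delta_0+p\,t_2\delta_A)$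 with $t_1,t_2$ the probabilities of type I and type II errors in a single test. Bayes oracle: the rule minimizing $R$; it rejects $H_{0i}$ iff $X_i^2/\sigma^2\ge(1+\frac1u)\left(\log v+\log(1+\frac1u)\right)$, where $u=\tau^2/\sigma^2$, $f=(1-p)/p$, $\delta=\delta_0/\delta_A$, $v=uf^2\delta^2$. Its Bayes risk is denoted $R_{\mathrm{opt}}$. ABOS (asymptotically Bayes optimal under sparsity): a rule with risk $R$ is ABOS for the sequence $\gamma_t$ if $R/R_{\mathrm{opt}}\to1$ as $t\to\infty$. The number of tests $m=m_t$ may vary with $t$. *)

theory Defs
  imports "HOL-Probability.Probability" "HOL-Library.Landau_Symbols"
begin

text \<open>
  The two-groups normal mixture model for \<open>m\<close> tests, indexed by \<open>1, \<dots>, m\<close>, on an arbitrary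
  probability space. \<open>p\<close> is the sparsity, and \<open>s2\<close>, \<open>t2\<close> are the variances \<open>\<sigma>\<^sup>2\<close>, \<open>\<tau>\<^sup>2\<close>; the library's
  \<^const>\<open>normal_density\<close> takes a standard deviation, hence the square roots. For an event \<open>A\<close> of
  positive probability, \<open>uniform_measure M A\<close> is the conditional probability given \<open>A\<close>.
  Independence is that of the pairs \<open>(\<nu>\<^sub>i, X\<^sub>i)\<close>; that these are identically distributed follows from
  the last four assumptions.
\<close>

locale two_groups_model = prob_space M
  for M :: "'a measure" and m :: nat and p s2 t2 :: real
    and \<nu> :: "nat \<Rightarrow> 'a \<Rightarrow> nat" and X :: "nat \<Rightarrow> 'a \<Rightarrow> real" +
  assumes m_pos: "m \<ge> 1"
    and p_pos: "0 < p" and p_less_1: "p < 1"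
    and s2_pos: "s2 > 0" and t2_pos: "t2 > 0"
    and indep: "indep_vars (\<lambda>_. count_space UNIV \<Otimes>\<^sub>M borel) (\<lambda>i \<omega>. (\<nu> i \<omega>, X i \<omega>)) {1..m}"
    and prob_alt: "\<And>i. i \<in> {1..m} \<Longrightarrow> prob {\<omega> \<in> space M. \<nu> i \<omega> = 1} = p"
    and prob_null: "\<And>i. i \<in> {1..m} \<Longrightarrow> prob {\<omega> \<in> space M. \<nu> i \<omega> = 0} = 1 - p"
    and distr_null: "\<And>i. i \<in> {1..m} \<Longrightarrow>
      distributed (uniform_measure M {\<omega> \<in> space M. \<nu> i \<omega> = 0}) lborel (X i)
        (normal_density 0 (sqrt s2))"
    and distr_alt: "\<And>i. i \<in> {1..m} \<Longrightarrow>
      distributed (uniform_measure M {\<omega> \<in> space M. \<nu> i \<omega> = 1}) lborel (X i)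
        (normal_density 0 (sqrt (s2 + t2)))"

text \<open>
  A multiple testing rule sees only the observations \<open>x = (x\<^sub>1, \<dots>, x\<^sub>m)\<close>, and \<open>\<phi> x i\<close> means that
  \<open>H\<^sub>0\<^sub>i\<close> is rejected. The decision on \<open>H\<^sub>0\<^sub>i\<close> may depend on all of the observations.
\<close>

type_synonym testing_rule = "(nat \<Rightarrow> real) \<Rightarrow> nat \<Rightarrow> bool"

definition testing_rules :: "nat \<Rightarrow> testing_rule set" where
  "testing_rules m =
    {\<phi>. \<forall>i\<in>{1..m}. (\<lambda>x. \<phi> x i) \<in> (\<Pi>\<^sub>M j\<in>{1..m}. (borel :: real measure)) \<rightarrow>\<^sub>M count_space UNIV}"

definition threshold_rule :: "real \<Rightarrow> real \<Rightarrow> testing_rule" where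
  "threshold_rule s2 k x i \<longleftrightarrow> (x i)\<^sup>2 / s2 \<ge> k"

definition false_rejections ::
    "nat \<Rightarrow> (nat \<Rightarrow> 'a \<Rightarrow> nat) \<Rightarrow> (nat \<Rightarrow> 'a \<Rightarrow> real) \<Rightarrow> testing_rule \<Rightarrow> 'a \<Rightarrow> nat" where
  "false_rejections m \<nu> X \<phi> \<omega> =
    card {i \<in> {1..m}. \<nu> i \<omega> = 0 \<and> \<phi> (\<lambda>j\<in>{1..m}. X j \<omega>) i}"

definition false_acceptances ::
    "nat \<Rightarrow> (nat \<Rightarrow> 'a \<Rightarrow> nat) \<Rightarrow> (nat \<Rightarrow> 'a \<Rightarrow> real) \<Rightarrow> testing_rule \<Rightarrow> 'a \<Rightarrow> nat" where
  "false_acceptances m \<nu> X \<phi> \<omega> =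
    card {i \<in> {1..m}. \<nu> i \<omega> = 1 \<and> \<not> \<phi> (\<lambda>j\<in>{1..m}. X j \<omega>) i}"

definition bayes_risk ::
    "'a measure \<Rightarrow> nat \<Rightarrow> real \<Rightarrow> real \<Rightarrow> (nat \<Rightarrow> 'a \<Rightarrow> nat) \<Rightarrow> (nat \<Rightarrow> 'a \<Rightarrow> real) \<Rightarrow> testing_rule \<Rightarrow> real"
  where
  "bayes_risk M m \<delta>\<^sub>0 \<delta>\<^sub>A \<nu> X \<phi> =
    \<delta>\<^sub>0 * (\<integral>\<omega>. real (false_rejections m \<nu> X \<phi> \<omega>) \<partial>M) +
    \<delta>\<^sub>A * (\<integral>\<omega>. real (false_acceptances m \<nu> X \<phi> \<omega>) \<partial>M)"

text \<open>
  The risk of the Bayes oracle. The infimum is a minimum: with \<open>u\<close> and \<open>v\<close> as below it is attained by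
  \<open>threshold_rule s2 ((1 + 1 / u) * (ln v + ln (1 + 1 / u)))\<close>.
\<close>

definition optimal_risk ::
    "'a measure \<Rightarrow> nat \<Rightarrow> real \<Rightarrow> real \<Rightarrow> (nat \<Rightarrow> 'a \<Rightarrow> nat) \<Rightarrow> (nat \<Rightarrow> 'a \<Rightarrow> real) \<Rightarrow> real" where
  "optimal_risk M m \<delta>\<^sub>0 \<delta>\<^sub>A \<nu> X = (INF \<phi>\<in>testing_rules m. bayes_risk M m \<delta>\<^sub>0 \<delta>\<^sub>A \<nu> X \<phi>)"

definition ABOS ::
    "(nat \<Rightarrow> 'a measure) \<Rightarrow> (nat \<Rightarrow> nat) \<Rightarrow> (nat \<Rightarrow> real) \<Rightarrow> (nat \<Rightarrow> real) \<Rightarrow>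
     (nat \<Rightarrow> nat \<Rightarrow> 'a \<Rightarrow> nat) \<Rightarrow> (nat \<Rightarrow> nat \<Rightarrow> 'a \<Rightarrow> real) \<Rightarrow> (nat \<Rightarrow> testing_rule) \<Rightarrow> bool" where
  "ABOS M m \<delta>\<^sub>0 \<delta>\<^sub>A \<nu> X \<phi> \<longleftrightarrow>
    (\<lambda>t. bayes_risk (M t) (m t) (\<delta>\<^sub>0 t) (\<delta>\<^sub>A t) (\<nu> t) (X t) (\<phi> t) /
         optimal_risk (M t) (m t) (\<delta>\<^sub>0 t) (\<delta>\<^sub>A t) (\<nu> t) (X t)) \<longlonglongrightarrow> 1"

definition u_par :: "real \<Rightarrow> real \<Rightarrow> real" where
  "u_par s2 t2 = t2 / s2"

definition v_par :: "real \<Rightarrow> real \<Rightarrow> real \<Rightarrow> real \<Rightarrow> real \<Rightarrow> real" where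
  "v_par p s2 t2 \<delta>\<^sub>0 \<delta>\<^sub>A = u_par s2 t2 * ((1 - p) / p)\<^sup>2 * (\<delta>\<^sub>0 / \<delta>\<^sub>A)\<^sup>2"

end

theory Submission
  imports Defs "HOL-Real_Asymp.Real_Asymp"
begin

text \<open>
  Write \<open>L = log v\<close> and let \<open>T a\<close> be the probability that \<open>N\<^sup>2 \<ge> a\<close> for a standard normal \<open>N\<close>. Divided
  by \<open>m p \<delta>\<^sub>A\<close>, the Bayes risk of the rule with threshold \<open>a\<close> is \<open>\<surd>(v / u) T a + (1 - T (a / (1 + u)))\<close>,
  the sum of a type I and a type II part, since \<open>\<surd>(v / u) = f \<delta>\<close>.

  The optimal risk need not be computed exactly. Where \<open>X\<^sub>i\<^sup>2 / \<sigma>\<^sup>2 < L\<close> the weighted density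
  \<open>\<delta>\<^sub>A p f\<^sub>1\<close> of the alternative is below the weighted density \<open>\<delta>\<^sub>0 (1 - p) f\<^sub>0\<close> of the null. There, by
  independence, each rejection that any rule makes could be replaced by an acceptance at no extra cost,
  even if the decision uses the other observations. So every rule has normalized risk at least
  \<open>1 - T (L / (1 + u))\<close> (\<open>bayes_risk_ge\<close>). The threshold \<open>a = L\<close> achieves this up to its type I part,
  which tends to \<open>0\<close>, so the normalized optimal risk tends to \<open>1 - T C > 0\<close>, and the rule is
  asymptotically optimal if and only if its own normalized risk tends to \<open>1 - T C\<close>.

  For \<open>a = L + z\<close> that is decided by two facts. \<open>T\<close> is continuous and strictly decreasing, so the type II
  part tends to \<open>1 - T C\<close> as soon as \<open>z / L \<rightarrow> 0\<close>. And \<open>T a\<close> is of exact order \<open>exp (- a / 2) / \<surd>a\<close>, so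
  if \<open>z / L \<rightarrow> 0\<close>, then the type I part is of exact order \<open>exp (- (z + 2 log L) / 2)\<close>
  (\<open>null_risk_bounds\<close>) and tends to \<open>0\<close> if and only if \<open>z + 2 log L \<rightarrow> \<infinity>\<close>. Conversely, convergence of
  the risk to \<open>1 - T C\<close> forces \<open>z / L \<rightarrow> 0\<close> (\<open>risk_limit_imp_offset_negligible\<close>): if \<open>z \<ge> \<epsilon> L\<close>
  infinitely often, then the type II part alone stays above \<open>1 - T C\<close>, and if \<open>z \<le> - \<epsilon> L\<close> infinitely
  often, then the type I part is unbounded.
\<close>

section \<open>The tail of the chi-square distribution with one degree of freedom\<close>

text \<open>
  The probability that the square of a standard normal variable is at least \<open>a\<close>, for any real \<open>a\<close>.
\<close>

definition chisq_tail :: "real \<Rightarrow> real" where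
  "chisq_tail a = measure std_normal_distribution {x. a \<le> x\<^sup>2}"

interpretation std_normal: real_distribution std_normal_distribution
  by (rule real_dist_normal_dist)

lemma chisq_tail_le_1: "chisq_tail a \<le> 1"
  unfolding chisq_tail_def by (rule std_normal.prob_le_1)

lemma chisq_tail_nonneg: "0 \<le> chisq_tail a"
  unfolding chisq_tail_def by (rule measure_nonneg)

lemma chisq_tail_antimono: "a \<le> b \<Longrightarrow> chisq_tail b \<le> chisq_tail a"
  unfolding chisq_tail_def by (intro std_normal.finite_measure_mono) auto

lemma chisq_tail_zero: "chisq_tail 0 = 1"
  unfolding chisq_tail_def using std_normal.prob_space by simp

lemma emeasure_std_normal:
  "A \<in> sets borel \<Longrightarrow>
    emeasure std_normal_distribution A = (\<integral>\<^sup>+x. ennreal (std_normal_density x) * indicator A x \<partial>lborel)"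
  by (subst emeasure_density) auto

text \<open>
  The density decreases on the positive half-line, so it is at least its value at the right end. This
  bound gives both the strict monotonicity of the tail and its lower estimate.
\<close>

lemma std_normal_interval_ge:
  assumes "0 \<le> r" "r \<le> s"
  shows "(s - r) * std_normal_density s \<le> measure std_normal_distribution {r..<s}"
proof -
  have le: "std_normal_density s \<le> std_normal_density x" if "x \<in> {r..<s}" for x
    using that assms by (auto simp: std_normal_density_def intro!: divide_right_mono power_mono)
  have "ennreal ((s - r) * std_normal_density s)
      = (\<integral>\<^sup>+x. ennreal (std_normal_density s) * indicator {r..<s} x \<partial>lborel)"
    using assms by (simp add: nn_integral_cmult_indicator ennreal_mult mult.commute)
  also have "\<dots> \<le> (\<integral>\<^sup>+x. ennreal (std_normal_density x) * indicator {r..<s} x \<partial>lborel)"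
    using le by (intro nn_integral_mono) (auto simp: indicator_def)
  also have "\<dots> = emeasure std_normal_distribution {r..<s}"
    by (simp add: emeasure_std_normal)
  finally show ?thesis
    by (simp add: std_normal.emeasure_eq_measure)
qed

lemma std_normal_singleton: "measure std_normal_distribution {x} = 0"
proof -
  have "emeasure std_normal_distribution {x} = 0"
    by (subst emeasure_std_normal)
      (auto intro!: nn_integral_null_set simp: null_sets_def)
  then show ?thesis by (simp add: measure_def)
qed

lemma le_square_iff: "a \<le> x\<^sup>2 \<longleftrightarrow> x \<le> - sqrt a \<or> sqrt a \<le> x"
  for a x :: real
proof -
  have "a \<le> x\<^sup>2 \<longleftrightarrow> sqrt a \<le> \<bar>x\<bar>"
    by (metis real_sqrt_abs real_sqrt_le_iff)
  then show ?thesis by linarith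
qed

lemma chisq_tail_eq_cdf:
  assumes "0 \<le> a"
  shows "chisq_tail a = 1 - (cdf std_normal_distribution (sqrt a) - cdf std_normal_distribution (- sqrt a))"
proof -
  have "cdf std_normal_distribution (sqrt a) - cdf std_normal_distribution (- sqrt a)
      = measure std_normal_distribution {- sqrt a<..sqrt a}"
  proof (cases "a = 0")
    case False
    then show ?thesis using assms by (subst std_normal.cdf_diff_eq) auto
  qed auto
  also have "\<dots> = measure std_normal_distribution {- sqrt a<..<sqrt a}"
  proof (cases "a = 0")
    case False
    then have "{- sqrt a<..sqrt a} = {- sqrt a<..<sqrt a} \<union> {sqrt a}"
      using assms by (auto simp: neg_less_iff_less)
    then have "measure std_normal_distribution {- sqrt a<..sqrt a}
        = measure std_normal_distribution ({- sqrt a<..<sqrt a} \<union> {sqrt a})"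
      by simp
    also have "\<dots> = measure std_normal_distribution {- sqrt a<..<sqrt a}
        + measure std_normal_distribution {sqrt a}"
      by (rule std_normal.finite_measure_Union) auto
    finally show ?thesis
      by (simp add: std_normal_singleton)
  qed auto
  also have "{- sqrt a<..<sqrt a} = UNIV - {x. a \<le> x\<^sup>2}"
    by (auto simp: le_square_iff)
  finally show ?thesis
    unfolding chisq_tail_def using std_normal.prob_compl[of "{x. a \<le> x\<^sup>2}"] by simp
qed

lemma chisq_tail_tendsto:
  assumes lim: "(f \<longlongrightarrow> a) F" and a: "0 < a"
  shows "((\<lambda>t. chisq_tail (f t)) \<longlongrightarrow> chisq_tail a) F"
proof -
  have cont: "isCont (cdf std_normal_distribution) x" for x
    by (simp add: std_normal.isCont_cdf std_normal_singleton)
  have "((\<lambda>t. 1 - (cdf std_normal_distribution (sqrt (f t)) - cdf std_normal_distribution (- sqrt (f t))))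
      \<longlongrightarrow> 1 - (cdf std_normal_distribution (sqrt a) - cdf std_normal_distribution (- sqrt a))) F"
    by (intro tendsto_intros isCont_tendsto_compose[OF cont] lim)
  moreover have "eventually (\<lambda>t. 1 - (cdf std_normal_distribution (sqrt (f t))
      - cdf std_normal_distribution (- sqrt (f t))) = chisq_tail (f t)) F"
    using order_tendstoD(1)[OF lim a] by eventually_elim (simp add: chisq_tail_eq_cdf)
  ultimately show ?thesis
    using a by (simp add: chisq_tail_eq_cdf tendsto_cong)
qed

lemma chisq_tail_strict_antimono:
  assumes "0 \<le> a" "a < b"
  shows "chisq_tail b < chisq_tail a"
proof -
  have sub: "{sqrt a..<sqrt b} \<subseteq> {x. a \<le> x\<^sup>2} - {x. b \<le> x\<^sup>2}"
  proof -
    have "0 \<le> sqrt a" "0 < sqrt b" using assms by auto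
    then show ?thesis unfolding le_square_iff
      by (auto simp del: real_sqrt_ge_0_iff real_sqrt_gt_0_iff)
  qed
  have "0 < (sqrt b - sqrt a) * std_normal_density (sqrt b)"
    using assms by (simp add: std_normal_density_def)
  also have "\<dots> \<le> measure std_normal_distribution {sqrt a..<sqrt b}"
    using assms by (intro std_normal_interval_ge) auto
  also have "\<dots> \<le> measure std_normal_distribution ({x. a \<le> x\<^sup>2} - {x. b \<le> x\<^sup>2})"
    by (intro std_normal.finite_measure_mono sub) auto
  also have "\<dots> = chisq_tail a - chisq_tail b"
    unfolding chisq_tail_def using assms by (intro std_normal.finite_measure_Diff) auto
  finally show ?thesis by simp
qed

text \<open>
  The lower half of the estimate \<open>T a \<asymp> exp (- a / 2) / \<surd>a\<close>. Only the order matters, so the mass of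
  one short interval above \<open>\<surd>a\<close> suffices.
\<close>

lemma chisq_tail_ge:
  assumes "1 \<le> a"
  shows "exp (- 2) / sqrt (2 * pi) * (exp (- a / 2) / sqrt a) \<le> chisq_tail a"
proof -
  \<comment> \<open>An interval of length \<open>1 / sqrt a\<close>, over which the density drops only by a bounded factor.\<close>
  let ?s = "sqrt a + 1 / sqrt a"
  have a: "0 < a" "1 \<le> sqrt a" using assms by auto
  have "?s\<^sup>2 = a + 2 + 1 / a"
    using a by (simp add: power2_sum power_divide)
  then have "?s\<^sup>2 / 2 \<le> a / 2 + 2" using assms by (simp add: field_simps)
  then have "exp (- 2) * exp (- a / 2) \<le> exp (- ?s\<^sup>2 / 2)"
    by (simp add: exp_add[symmetric])
  then have "exp (- 2) * exp (- a / 2) / sqrt (2 * pi) \<le> std_normal_density ?s"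
    by (simp add: std_normal_density_def divide_right_mono)
  then have "1 / sqrt a * (exp (- 2) * exp (- a / 2) / sqrt (2 * pi)) \<le> (?s - sqrt a) * std_normal_density ?s"
    using a by (simp add: field_simps)
  also have "\<dots> \<le> measure std_normal_distribution {sqrt a..<?s}"
    using a by (intro std_normal_interval_ge) auto
  also have "\<dots> \<le> chisq_tail a"
    unfolding chisq_tail_def using a
    by (intro std_normal.finite_measure_mono) (auto intro: sqrt_le_D)
  finally show ?thesis by (simp add: field_simps)
qed

text \<open>
  The classical estimate: on \<open>[s, \<infinity>)\<close> the density is at most \<open>x / s\<close> times itself, which has the
  antiderivative \<open>- \<phi> x / s\<close>.
\<close>

lemma std_normal_upper_tail_le:
  assumes s: "0 < s"
  shows "measure std_normal_distribution {s..} \<le> std_normal_density s / s"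
proof -
  let ?\<phi> = std_normal_density
  have lim: "((\<lambda>x. - ?\<phi> x / s) \<longlongrightarrow> 0) at_top"
    unfolding std_normal_density_def using s by real_asymp
  have "emeasure std_normal_distribution {s..} = (\<integral>\<^sup>+x. ennreal (?\<phi> x) * indicator {s..} x \<partial>lborel)"
    by (simp add: emeasure_std_normal)
  also have "\<dots> \<le> (\<integral>\<^sup>+x. ennreal (x * ?\<phi> x / s) * indicator {s..} x \<partial>lborel)"
    using s by (intro nn_integral_mono)
      (auto simp: indicator_def field_simps intro!: ennreal_leI mult_right_mono)
  also have "\<dots> = ennreal (0 - (- ?\<phi> s / s))"
    using s lim
    by (intro nn_integral_FTC_atLeast[where F = "\<lambda>x. - ?\<phi> x / s"])
      (auto simp: std_normal_density_def field_simps intro!: derivative_eq_intros)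
  finally show ?thesis
    using s by (simp add: std_normal.emeasure_eq_measure)
qed

lemma std_normal_lower_tail:
  "measure std_normal_distribution {..- s} = measure std_normal_distribution {s..}"
proof -
  have "emeasure std_normal_distribution {..- s}
      = (\<integral>\<^sup>+x. ennreal (std_normal_density x) * indicator {..- s} x \<partial>lborel)"
    by (simp add: emeasure_std_normal)
  also have "\<dots> = (\<integral>\<^sup>+x. ennreal (std_normal_density x) * indicator {s..} x \<partial>lborel)"
    by (subst nn_integral_real_affine[where c = "- 1" and t = 0])
      (auto simp: std_normal_density_def indicator_def intro!: nn_integral_cong)
  finally show ?thesis by (simp add: emeasure_std_normal measure_def)
qed

lemma chisq_tail_le:
  assumes a: "0 < a"
  shows "chisq_tail a \<le> 2 / sqrt (2 * pi) * (exp (- a / 2) / sqrt a)"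
proof -
  have "{x. a \<le> x\<^sup>2} = {sqrt a..} \<union> {..- sqrt a}"
    by (auto simp: le_square_iff)
  then have "chisq_tail a \<le> measure std_normal_distribution {sqrt a..} + measure std_normal_distribution {..- sqrt a}"
    unfolding chisq_tail_def by (simp add: measure_Un_le)
  also have "\<dots> \<le> 2 * (std_normal_density (sqrt a) / sqrt a)"
    using std_normal_upper_tail_le[of "sqrt a"] a by (simp add: std_normal_lower_tail)
  also have "\<dots> = 2 / sqrt (2 * pi) * (exp (- a / 2) / sqrt a)"
    using a by (simp add: std_normal_density_def)
  finally show ?thesis .
qed

lemma normal_tail:
  assumes s: "0 < s"
  shows "measure (density lborel (normal_density 0 s)) {x. k * s\<^sup>2 \<le> x\<^sup>2} = chisq_tail k"
proof -
  let ?N = "density lborel (normal_density 0 s)"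
  interpret N: prob_space ?N using s by (rule prob_space_normal_density)
  have "distributed ?N lborel (\<lambda>x. x) (normal_density 0 s)"
    unfolding distributed_def by (auto intro!: distr_id2)
  then have "distributed ?N lborel (\<lambda>x. x / s) std_normal_density"
    using N.normal_standard_normal_convert[OF s, of "\<lambda>x. x" 0] by simp
  then have "measure std_normal_distribution {x. k \<le> x\<^sup>2}
      = measure (distr ?N lborel (\<lambda>x. x / s)) {x. k \<le> x\<^sup>2}"
    by (simp add: distributed_distr_eq_density)
  also have "\<dots> = measure ?N {x. k \<le> (x / s)\<^sup>2}"
    by (subst measure_distr) (auto simp: vimage_def)
  also have "{x. k \<le> (x / s)\<^sup>2} = {x. k * s\<^sup>2 \<le> x\<^sup>2}"
    using s by (simp add: power_divide pos_le_divide_eq)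
  finally show ?thesis by (simp add: chisq_tail_def)
qed

section \<open>Bayes risk in the two-groups model\<close>

context two_groups_model
begin

text \<open>
  The vector of all observations, as it is passed to a testing rule.
\<close>

definition obs :: "'a \<Rightarrow> nat \<Rightarrow> real" where
  "obs \<omega> = (\<lambda>j\<in>{1..m}. X j \<omega>)"

lemma random_variable_pair:
  "i \<in> {1..m} \<Longrightarrow> (\<lambda>\<omega>. (\<nu> i \<omega>, X i \<omega>)) \<in> measurable M (count_space UNIV \<Otimes>\<^sub>M borel)"
  using indep unfolding indep_vars_def by auto

lemma measurable_nu [measurable]: "i \<in> {1..m} \<Longrightarrow> \<nu> i \<in> measurable M (count_space UNIV)"
  using measurable_compose[OF random_variable_pair measurable_fst] by simp

lemma measurable_X [measurable]: "i \<in> {1..m} \<Longrightarrow> X i \<in> borel_measurable M"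
  using measurable_compose[OF random_variable_pair measurable_snd] by simp

lemma measurable_obs [measurable]: "obs \<in> measurable M (PiM {1..m} (\<lambda>_. borel))"
  unfolding obs_def by (intro measurable_restrict measurable_X)

text \<open>
  The common form of the null and the alternative: the joint law of the indicator and the observation of
  one test, from the prior weight \<open>q\<close> and the conditional density \<open>f\<close>.
\<close>

lemma emeasure_group_observation:
  assumes i: "i \<in> {1..m}" and A: "A \<in> sets borel"
    and q: "prob {\<omega> \<in> space M. \<nu> i \<omega> = j} = q" "q > 0"
    and distr: "distributed (uniform_measure M {\<omega> \<in> space M. \<nu> i \<omega> = j}) lborel (X i) f"
  shows "emeasure M {\<omega> \<in> space M. \<nu> i \<omega> = j \<and> X i \<omega> \<in> A} = ennreal q * emeasure (density lborel f) A"
proof -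
  let ?E = "{\<omega> \<in> space M. \<nu> i \<omega> = j}"
  have E[measurable]: "?E \<in> sets M" using i by measurable
  have XA[measurable]: "X i -` A \<inter> space M \<in> sets M"
    using measurable_X[OF i] A by (rule measurable_sets)
  have "emeasure (density lborel f) A = emeasure (distr (uniform_measure M ?E) lborel (X i)) A"
    using distr by (simp add: distributed_distr_eq_density)
  also have "\<dots> = emeasure (uniform_measure M ?E) (X i -` A \<inter> space M)"
    using distr A by (subst emeasure_distr) (auto simp: distributed_def)
  also have "\<dots> = emeasure M (?E \<inter> (X i -` A \<inter> space M)) / emeasure M ?E"
    by (rule emeasure_uniform_measure) measurable
  also have "?E \<inter> (X i -` A \<inter> space M) = {\<omega> \<in> space M. \<nu> i \<omega> = j \<and> X i \<omega> \<in> A}"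
    by auto
  also have "emeasure M ?E = ennreal q" using q by (simp add: emeasure_eq_measure)
  finally show ?thesis
    using q by (simp add: ennreal_times_divide mult_divide_eq_ennreal mult.commute[of "ennreal q"])
qed

lemma emeasure_null_observation:
  "i \<in> {1..m} \<Longrightarrow> A \<in> sets borel \<Longrightarrow> emeasure M {\<omega> \<in> space M. \<nu> i \<omega> = 0 \<and> X i \<omega> \<in> A}
    = ennreal (1 - p) * emeasure (density lborel (normal_density 0 (sqrt s2))) A"
  using p_less_1 by (intro emeasure_group_observation prob_null distr_null) auto

lemma emeasure_alt_observation:
  "i \<in> {1..m} \<Longrightarrow> A \<in> sets borel \<Longrightarrow> emeasure M {\<omega> \<in> space M. \<nu> i \<omega> = 1 \<and> X i \<omega> \<in> A}
    = ennreal p * emeasure (density lborel (normal_density 0 (sqrt (s2 + t2)))) A"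
  using p_pos by (intro emeasure_group_observation prob_alt distr_alt) auto

lemma prob_null_tail:
  assumes "i \<in> {1..m}"
  shows "prob {\<omega> \<in> space M. \<nu> i \<omega> = 0 \<and> k \<le> (X i \<omega>)\<^sup>2 / s2} = (1 - p) * chisq_tail k"
proof -
  interpret N: prob_space "density lborel (normal_density 0 (sqrt s2))"
    using s2_pos by (intro prob_space_normal_density) simp
  have "{x. k * (sqrt s2)\<^sup>2 \<le> x\<^sup>2} = {x. k \<le> x\<^sup>2 / s2}"
    using s2_pos by (simp add: pos_le_divide_eq)
  then show ?thesis
    using emeasure_null_observation[OF assms, of "{x. k \<le> x\<^sup>2 / s2}"]
      normal_tail[of "sqrt s2" k] s2_pos p_less_1
    by (simp add: emeasure_eq_measure N.emeasure_eq_measure ennreal_mult[symmetric] chisq_tail_nonneg)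
qed

lemma prob_alt_below:
  assumes i: "i \<in> {1..m}"
  shows "prob {\<omega> \<in> space M. \<nu> i \<omega> = 1 \<and> (X i \<omega>)\<^sup>2 / s2 < k}
    = p * (1 - chisq_tail (k / (1 + u_par s2 t2)))"
proof -
  let ?N = "density lborel (normal_density 0 (sqrt (s2 + t2)))"
  interpret N: prob_space ?N
    using s2_pos t2_pos by (intro prob_space_normal_density) simp
  have u: "k / (1 + u_par s2 t2) * (s2 + t2) = k * s2"
    using s2_pos t2_pos by (simp add: u_par_def field_simps)
  have "{x. x\<^sup>2 / s2 < k} = UNIV - {x. k / (1 + u_par s2 t2) * (sqrt (s2 + t2))\<^sup>2 \<le> x\<^sup>2}"
    using s2_pos t2_pos u by (auto simp: pos_divide_less_eq)
  then have "measure ?N {x. x\<^sup>2 / s2 < k} = 1 - chisq_tail (k / (1 + u_par s2 t2))"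
    using normal_tail[of "sqrt (s2 + t2)" "k / (1 + u_par s2 t2)"] s2_pos t2_pos
      N.prob_compl[of "{x. k / (1 + u_par s2 t2) * (sqrt (s2 + t2))\<^sup>2 \<le> x\<^sup>2}"] by simp
  then show ?thesis
    using emeasure_alt_observation[OF i, of "{x. x\<^sup>2 / s2 < k}"] p_pos chisq_tail_le_1
    by (simp add: emeasure_eq_measure N.emeasure_eq_measure ennreal_mult[symmetric])
qed

lemma measurable_rule:
  assumes "\<phi> \<in> testing_rules m" "i \<in> {1..m}"
  shows "{x \<in> space (PiM {1..m} (\<lambda>_. borel)). \<phi> x i} \<in> sets (PiM {1..m} (\<lambda>_. borel :: real measure))"
  using assms unfolding testing_rules_def by (auto intro!: predE simp: pred_def)

lemma obs_in_space: "obs \<omega> \<in> space (PiM {1..m} (\<lambda>_. borel))"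
  by (simp add: obs_def space_PiM)

lemma measurable_decision:
  assumes "\<phi> \<in> testing_rules m" "i \<in> {1..m}"
  shows "Measurable.pred M (\<lambda>\<omega>. \<phi> (obs \<omega>) i)"
proof -
  have "(\<lambda>x. \<phi> x i) \<in> measurable (PiM {1..m} (\<lambda>_. borel :: real measure)) (count_space UNIV)"
    using assms unfolding testing_rules_def by auto
  from measurable_compose[OF measurable_obs this] show ?thesis .
qed

lemma expectation_card:
  assumes "finite I" "\<And>i. i \<in> I \<Longrightarrow> Measurable.pred M (P i)"
  shows "(\<integral>\<omega>. real (card {i \<in> I. P i \<omega>}) \<partial>M) = (\<Sum>i\<in>I. prob {\<omega> \<in> space M. P i \<omega>})"
proof -
  have "(\<integral>\<omega>. real (card {i \<in> I. P i \<omega>}) \<partial>M) = (\<integral>\<omega>. (\<Sum>i\<in>I. indicator {\<omega> \<in> space M. P i \<omega>} \<omega>) \<partial>M)"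
  proof (rule Bochner_Integration.integral_cong)
    fix \<omega> assume "\<omega> \<in> space M"
    then have "(\<Sum>i\<in>I. indicator {\<omega> \<in> space M. P i \<omega>} \<omega> :: real) = (\<Sum>i\<in>I. of_bool (P i \<omega>))"
      by (intro sum.cong) (auto simp: indicator_def)
    then show "real (card {i \<in> I. P i \<omega>}) = (\<Sum>i\<in>I. indicator {\<omega> \<in> space M. P i \<omega>} \<omega>)"
      using assms(1) by (simp add: sum_of_bool_eq Int_def)
  qed simp
  also have "\<dots> = (\<Sum>i\<in>I. \<integral>\<omega>. indicator {\<omega> \<in> space M. P i \<omega>} \<omega> \<partial>M)"
    using assms by (intro Bochner_Integration.integral_sum) (auto simp: emeasure_eq_measure)
  also have "\<dots> = (\<Sum>i\<in>I. prob {\<omega> \<in> space M. P i \<omega>})"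
    using assms by (intro sum.cong) auto
  finally show ?thesis .
qed

lemma bayes_risk_eq_sum:
  assumes \<phi>: "\<phi> \<in> testing_rules m"
  shows "bayes_risk M m \<delta>\<^sub>0 \<delta>\<^sub>A \<nu> X \<phi> =
    (\<Sum>i=1..m. \<delta>\<^sub>0 * prob {\<omega> \<in> space M. \<nu> i \<omega> = 0 \<and> \<phi> (obs \<omega>) i}
      + \<delta>\<^sub>A * prob {\<omega> \<in> space M. \<nu> i \<omega> = 1 \<and> \<not> \<phi> (obs \<omega>) i})"
proof -
  note [measurable] = measurable_decision[OF \<phi>]
  show ?thesis
    unfolding bayes_risk_def false_rejections_def false_acceptances_def obs_def[symmetric]
    by (subst (1 2) expectation_card) (auto simp: sum.distrib sum_distrib_left)
qed

lemma threshold_rule_in_testing_rules: "threshold_rule s2 k \<in> testing_rules m"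
  unfolding testing_rules_def threshold_rule_def by auto

lemma bayes_risk_threshold:
  "bayes_risk M m \<delta>\<^sub>0 \<delta>\<^sub>A \<nu> X (threshold_rule s2 k) =
    real m * (\<delta>\<^sub>0 * (1 - p) * chisq_tail k
      + \<delta>\<^sub>A * p * (1 - chisq_tail (k / (1 + u_par s2 t2))))"
proof -
  have "bayes_risk M m \<delta>\<^sub>0 \<delta>\<^sub>A \<nu> X (threshold_rule s2 k) =
    (\<Sum>i=1..m. \<delta>\<^sub>0 * (1 - p) * chisq_tail k
      + \<delta>\<^sub>A * p * (1 - chisq_tail (k / (1 + u_par s2 t2))))"
    unfolding bayes_risk_eq_sum[OF threshold_rule_in_testing_rules]
  proof (rule sum.cong)
    fix i assume i: "i \<in> {1..m}"
    then have "threshold_rule s2 k (obs \<omega>) i \<longleftrightarrow> k \<le> (X i \<omega>)\<^sup>2 / s2" for \<omega>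
      by (simp add: threshold_rule_def obs_def)
    then show "\<delta>\<^sub>0 * prob {\<omega> \<in> space M. \<nu> i \<omega> = 0 \<and> threshold_rule s2 k (obs \<omega>) i}
      + \<delta>\<^sub>A * prob {\<omega> \<in> space M. \<nu> i \<omega> = 1 \<and> \<not> threshold_rule s2 k (obs \<omega>) i}
      = \<delta>\<^sub>0 * (1 - p) * chisq_tail k + \<delta>\<^sub>A * p * (1 - chisq_tail (k / (1 + u_par s2 t2)))"
      using prob_null_tail[OF i, of k] prob_alt_below[OF i, of k] by (simp add: not_le)
  qed simp
  then show ?thesis by simp
qed

text \<open>
  \<open>slice i y S\<close> is the set of values of the \<open>i\<close>-th observation that put the observation vector into \<open>S\<close>
  when \<open>y\<close> holds the data of the other tests. Those data are pairs of indicator and observation, because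
  independence is assumed for the pairs; the indicators are ignored.
\<close>

definition slice :: "nat \<Rightarrow> (nat \<Rightarrow> nat \<times> real) \<Rightarrow> (nat \<Rightarrow> real) set \<Rightarrow> real set" where
  "slice i y S = {x. (\<lambda>k\<in>{1..m}. if k = i then x else snd (y k)) \<in> S}"

text \<open>
  The joint law of the data of all tests except the \<open>i\<close>-th.
\<close>

definition law_others :: "nat \<Rightarrow> (nat \<Rightarrow> nat \<times> real) measure" where
  "law_others i = distr M (PiM ({1..m} - {i}) (\<lambda>_. count_space UNIV \<Otimes>\<^sub>M borel))
    (\<lambda>\<omega>. \<lambda>k\<in>{1..m} - {i}. (\<nu> k \<omega>, X k \<omega>))"

lemma slice_borel:
  assumes S: "S \<in> sets (PiM {1..m} (\<lambda>_. borel))"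
  shows "slice i y S \<in> sets borel"
proof -
  have "(\<lambda>x. \<lambda>k\<in>{1..m}. if k = i then x else snd (y k)) \<in> measurable borel (PiM {1..m} (\<lambda>_. borel))"
    by (intro measurable_restrict) auto
  from measurable_sets[OF this S] show ?thesis by (simp add: vimage_def slice_def)
qed

text \<open>
  The data of test \<open>i\<close> are independent of the rest, so by Fubini a joint probability can be computed by
  conditioning on the other tests.
\<close>

lemma
  assumes i: "i \<in> {1..m}" and S: "S \<in> sets (PiM {1..m} (\<lambda>_. borel))"
  shows emeasure_group_obs: "emeasure M {\<omega> \<in> space M. \<nu> i \<omega> = j \<and> obs \<omega> \<in> S}
      = (\<integral>\<^sup>+y. emeasure M {\<omega> \<in> space M. \<nu> i \<omega> = j \<and> X i \<omega> \<in> slice i y S} \<partial>law_others i)"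
    and measurable_slice_prob: "(\<lambda>y. emeasure M {\<omega> \<in> space M. \<nu> i \<omega> = j \<and> X i \<omega> \<in> slice i y S})
      \<in> borel_measurable (law_others i)"
proof -
  let ?I = "{1..m} - {i}" and ?N = "count_space UNIV \<Otimes>\<^sub>M borel :: (nat \<times> real) measure"
  let ?W = "\<lambda>J \<omega>. \<lambda>k\<in>J. (\<nu> k \<omega>, X k \<omega>)" and ?P = "\<lambda>J. PiM J (\<lambda>_. ?N)"
  let ?Q = "law_others i"
  have "indep_var (?P {i}) (?W {i}) (?P ?I) (?W ?I)"
    using i by (intro indep_var_restrict[OF indep]) auto
  then have Z: "?W {i} \<in> measurable M (?P {i})" and Y: "?W ?I \<in> measurable M (?P ?I)"
    and prod: "distr M (?P {i}) (?W {i}) \<Otimes>\<^sub>M ?Q = distr M (?P {i} \<Otimes>\<^sub>M ?P ?I) (\<lambda>\<omega>. (?W {i} \<omega>, ?W ?I \<omega>))"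
    unfolding law_others_def by (simp_all add: indep_var_distribution_eq)
  interpret Z: prob_space "distr M (?P {i}) (?W {i})" using Z by (rule prob_space_distr)
  interpret Q: prob_space ?Q unfolding law_others_def using Y by (rule prob_space_distr)
  interpret ZQ: pair_prob_space "distr M (?P {i}) (?W {i})" ?Q ..
  define join where
    "join = (\<lambda>w. \<lambda>k\<in>{1..m}. if k = i then snd (fst w i :: nat \<times> real) else snd (snd w k :: nat \<times> real))"
  have join: "join \<in> measurable (?P {i} \<Otimes>\<^sub>M ?P ?I) (PiM {1..m} (\<lambda>_. borel))"
    unfolding join_def
  proof (rule measurable_restrict)
    fix k assume k: "k \<in> {1..m}"
    show "(\<lambda>w. if k = i then snd (fst w i) else snd (snd w k)) \<in> borel_measurable (?P {i} \<Otimes>\<^sub>M ?P ?I)"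
    proof (cases "k = i")
      case False
      then have "k \<in> ?I" using k by simp
      note [measurable] = measurable_component_singleton[OF this, of "\<lambda>_. ?N"]
      have "(\<lambda>w. snd (snd w k)) \<in> borel_measurable (?P {i} \<Otimes>\<^sub>M ?P ?I)"
        by measurable
      then show ?thesis using False by (simp only: if_False)
    qed simp
  qed
  let ?D = "{w \<in> space (?P {i} \<Otimes>\<^sub>M ?P ?I). fst (fst w i) = j \<and> join w \<in> S}"
  have D: "?D \<in> sets (?P {i} \<Otimes>\<^sub>M ?P ?I)"
  proof -
    note [measurable] = join S
    show ?thesis by measurable
  qed
  have D': "?D \<in> sets (distr M (?P {i}) (?W {i}) \<Otimes>\<^sub>M ?Q)"
    using D by (simp add: law_others_def cong: sets_pair_measure_cong)
  have join_obs: "join (?W {i} \<omega>, ?W ?I \<omega>) = obs \<omega>" for \<omega>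
    using i by (auto simp: obs_def join_def fun_eq_iff)
  have join_slice: "join (?W {i} \<omega>, y) \<in> S \<longleftrightarrow> X i \<omega> \<in> slice i y S" for \<omega> y
  proof -
    have "join (?W {i} \<omega>, y) = (\<lambda>k\<in>{1..m}. if k = i then X i \<omega> else snd (y k))"
      by (auto simp: join_def fun_eq_iff)
    then show ?thesis by (simp add: slice_def)
  qed
  have "emeasure (distr M (?P {i} \<Otimes>\<^sub>M ?P ?I) (\<lambda>\<omega>. (?W {i} \<omega>, ?W ?I \<omega>))) ?D
      = emeasure M ((\<lambda>\<omega>. (?W {i} \<omega>, ?W ?I \<omega>)) -` ?D \<inter> space M)"
    using measurable_Pair[OF Z Y] D by (rule emeasure_distr)
  also have "(\<lambda>\<omega>. (?W {i} \<omega>, ?W ?I \<omega>)) -` ?D \<inter> space M = {\<omega> \<in> space M. \<nu> i \<omega> = j \<and> obs \<omega> \<in> S}"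
    using measurable_space[OF measurable_Pair[OF Z Y]] by (auto simp: join_obs simp del: One_nat_def)
  finally have joint: "emeasure (distr M (?P {i}) (?W {i}) \<Otimes>\<^sub>M ?Q) ?D
      = emeasure M {\<omega> \<in> space M. \<nu> i \<omega> = j \<and> obs \<omega> \<in> S}"
    unfolding prod .
  have slice_eq: "emeasure (distr M (?P {i}) (?W {i})) ((\<lambda>z. (z, y)) -` ?D)
      = emeasure M {\<omega> \<in> space M. \<nu> i \<omega> = j \<and> X i \<omega> \<in> slice i y S}" if y: "y \<in> space ?Q" for y
  proof -
    have "emeasure (distr M (?P {i}) (?W {i})) ((\<lambda>z. (z, y)) -` ?D)
        = emeasure M (?W {i} -` ((\<lambda>z. (z, y)) -` ?D) \<inter> space M)"
      using Z sets_Pair2[OF D] by (rule emeasure_distr)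
    also have "?W {i} -` ((\<lambda>z. (z, y)) -` ?D) \<inter> space M
        = {\<omega> \<in> space M. \<nu> i \<omega> = j \<and> X i \<omega> \<in> slice i y S}"
      using measurable_space[OF Z] y by (auto simp: join_slice law_others_def space_pair_measure)
    finally show ?thesis .
  qed
  show "emeasure M {\<omega> \<in> space M. \<nu> i \<omega> = j \<and> obs \<omega> \<in> S}
    = (\<integral>\<^sup>+y. emeasure M {\<omega> \<in> space M. \<nu> i \<omega> = j \<and> X i \<omega> \<in> slice i y S} \<partial>?Q)"
    unfolding joint[symmetric] ZQ.emeasure_pair_measure_alt2[OF D']
    by (rule nn_integral_cong) (rule slice_eq)
  show "(\<lambda>y. emeasure M {\<omega> \<in> space M. \<nu> i \<omega> = j \<and> X i \<omega> \<in> slice i y S}) \<in> borel_measurable ?Q"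
    using ZQ.measurable_emeasure_Pair2[OF D'] by (subst (asm) measurable_cong[OF slice_eq])
qed

text \<open>
  If the weighted alternative density is below the weighted null density throughout \<open>S\<close>, then on \<open>S\<close> it
  costs no more to accept than to reject. The comparison of densities passes to each slice, and then to
  the joint law.
\<close>

lemma cost_alt_le_null:
  assumes i: "i \<in> {1..m}" and S: "S \<in> sets (PiM {1..m} (\<lambda>_. borel))"
    and \<delta>: "\<delta>\<^sub>0 > 0" "\<delta>\<^sub>A > 0"
    and le: "\<And>x. x \<in> S \<Longrightarrow> \<delta>\<^sub>A * p * normal_density 0 (sqrt (s2 + t2)) (x i)
      \<le> \<delta>\<^sub>0 * (1 - p) * normal_density 0 (sqrt s2) (x i)"
  shows "\<delta>\<^sub>A * prob {\<omega> \<in> space M. \<nu> i \<omega> = 1 \<and> obs \<omega> \<in> S}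
    \<le> \<delta>\<^sub>0 * prob {\<omega> \<in> space M. \<nu> i \<omega> = 0 \<and> obs \<omega> \<in> S}"
proof -
  let ?P = "\<lambda>j y. emeasure M {\<omega> \<in> space M. \<nu> i \<omega> = j \<and> X i \<omega> \<in> slice i y S}"
  have section_le: "ennreal \<delta>\<^sub>A * ?P 1 y \<le> ennreal \<delta>\<^sub>0 * ?P 0 y" for y
  proof -
    let ?A = "slice i y S"
    note A[measurable] = slice_borel[OF S, of i y]
    have ind: "indicator ?A x * ennreal (\<delta>\<^sub>A * p * normal_density 0 (sqrt (s2 + t2)) x)
      \<le> indicator ?A x * ennreal (\<delta>\<^sub>0 * (1 - p) * normal_density 0 (sqrt s2) x)" for x
      using le[of "\<lambda>k\<in>{1..m}. if k = i then x else snd (y k)"] i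
      by (auto simp: slice_def indicator_def intro: ennreal_leI)
    have "ennreal \<delta>\<^sub>A * ?P 1 y = ennreal (\<delta>\<^sub>A * p) *
        (\<integral>\<^sup>+x. ennreal (normal_density 0 (sqrt (s2 + t2)) x) * indicator ?A x \<partial>lborel)"
      using \<delta> p_pos by (subst emeasure_alt_observation[OF i A]) (simp add: emeasure_density ennreal_mult mult.assoc)
    also have "\<dots> = (\<integral>\<^sup>+x. indicator ?A x * ennreal (\<delta>\<^sub>A * p * normal_density 0 (sqrt (s2 + t2)) x) \<partial>lborel)"
      using \<delta> p_pos by (subst nn_integral_cmult[symmetric]) (auto simp: ennreal_mult mult_ac)
    also have "\<dots> \<le> (\<integral>\<^sup>+x. indicator ?A x * ennreal (\<delta>\<^sub>0 * (1 - p) * normal_density 0 (sqrt s2) x) \<partial>lborel)"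
      by (intro nn_integral_mono ind)
    also have "\<dots> = ennreal (\<delta>\<^sub>0 * (1 - p)) *
        (\<integral>\<^sup>+x. ennreal (normal_density 0 (sqrt s2) x) * indicator ?A x \<partial>lborel)"
      using \<delta> p_less_1 by (subst nn_integral_cmult[symmetric]) (auto simp: ennreal_mult mult_ac)
    also have "\<dots> = ennreal \<delta>\<^sub>0 * ?P 0 y"
      using \<delta> p_less_1 by (subst emeasure_null_observation[OF i A]) (simp add: emeasure_density ennreal_mult mult.assoc)
    finally show ?thesis .
  qed
  have "ennreal \<delta>\<^sub>A * emeasure M {\<omega> \<in> space M. \<nu> i \<omega> = 1 \<and> obs \<omega> \<in> S}
      \<le> ennreal \<delta>\<^sub>0 * emeasure M {\<omega> \<in> space M. \<nu> i \<omega> = 0 \<and> obs \<omega> \<in> S}"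
    unfolding emeasure_group_obs[OF i S]
      nn_integral_cmult[OF measurable_slice_prob[OF i S], symmetric]
    by (intro nn_integral_mono section_le)
  then show ?thesis
    using \<delta> by (simp add: emeasure_eq_measure ennreal_mult[symmetric])
qed

text \<open>
  For \<open>v \<ge> 1\<close> the threshold \<open>log v\<close> is below the exact threshold of the Bayes oracle, and the comparison
  is correspondingly easy: the factor \<open>exp (- x\<^sup>2 / (2 (\<sigma>\<^sup>2 + \<tau>\<^sup>2)))\<close> is bounded by \<open>1\<close>.
\<close>

lemma alt_density_le_null_density:
  assumes \<delta>: "\<delta>\<^sub>0 > 0" "\<delta>\<^sub>A > 0" and x: "x\<^sup>2 / s2 < ln (v_par p s2 t2 \<delta>\<^sub>0 \<delta>\<^sub>A)"
  shows "\<delta>\<^sub>A * p * normal_density 0 (sqrt (s2 + t2)) x \<le> \<delta>\<^sub>0 * (1 - p) * normal_density 0 (sqrt s2) x"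
proof -
  define v where "v = v_par p s2 t2 \<delta>\<^sub>0 \<delta>\<^sub>A"
  define r where "r = \<delta>\<^sub>0 * (1 - p) / (\<delta>\<^sub>A * p)"
  have r: "r > 0" using \<delta> p_pos p_less_1 by (simp add: r_def)
  have v_eq: "v = t2 / s2 * r\<^sup>2"
    by (simp add: v_def v_par_def u_par_def r_def power_divide power_mult_distrib mult_ac)
  have v: "v > 0" using r s2_pos t2_pos by (simp add: v_eq)
  have sqv: "exp (ln v / 2) = sqrt v" using v by (simp add: powr_half_sqrt[symmetric] powr_def)
  have "- x\<^sup>2 / (2 * (s2 + t2)) \<le> ln v / 2 - x\<^sup>2 / (2 * s2)"
  proof -
    have "- x\<^sup>2 / (2 * (s2 + t2)) \<le> 0" using s2_pos t2_pos by simp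
    moreover have "x\<^sup>2 / (2 * s2) = x\<^sup>2 / s2 / 2" by simp
    ultimately show "- x\<^sup>2 / (2 * (s2 + t2)) \<le> ln v / 2 - x\<^sup>2 / (2 * s2)"
      using x unfolding v_def[symmetric] by linarith
  qed
  then have "exp (- x\<^sup>2 / (2 * (s2 + t2))) \<le> sqrt v * exp (- x\<^sup>2 / (2 * s2))"
    unfolding sqv[symmetric] by (simp add: exp_add[symmetric])
  then have "exp (- x\<^sup>2 / (2 * (s2 + t2))) / sqrt (2 * pi * (s2 + t2))
      \<le> sqrt v * exp (- x\<^sup>2 / (2 * s2)) / sqrt (2 * pi * t2)"
    using s2_pos t2_pos v by (intro frac_le) (auto intro!: mult_nonneg_nonneg)
  also have "\<dots> = r * (exp (- x\<^sup>2 / (2 * s2)) / sqrt (2 * pi * s2))"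
    using s2_pos t2_pos r by (simp add: v_eq real_sqrt_mult real_sqrt_divide)
  finally have "normal_density 0 (sqrt (s2 + t2)) x \<le> r * normal_density 0 (sqrt s2) x"
    using s2_pos t2_pos by (simp add: normal_density_def)
  then have "\<delta>\<^sub>A * p * normal_density 0 (sqrt (s2 + t2)) x \<le> \<delta>\<^sub>A * p * (r * normal_density 0 (sqrt s2) x)"
    using \<delta> p_pos by (intro mult_left_mono) auto
  also have "\<dots> = \<delta>\<^sub>0 * (1 - p) * normal_density 0 (sqrt s2) x"
    using \<delta> p_pos by (simp add: r_def)
  finally show ?thesis .
qed

text \<open>
  The lower bound for an arbitrary rule: it is at least the cost of accepting every alternative with
  \<open>x\<^sub>i\<^sup>2 / \<sigma>\<^sup>2 < log v\<close>.
\<close>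

lemma bayes_risk_ge:
  assumes \<phi>: "\<phi> \<in> testing_rules m" and \<delta>: "\<delta>\<^sub>0 > 0" "\<delta>\<^sub>A > 0"
  shows "real m * (\<delta>\<^sub>A * p * (1 - chisq_tail (ln (v_par p s2 t2 \<delta>\<^sub>0 \<delta>\<^sub>A) / (1 + u_par s2 t2))))
    \<le> bayes_risk M m \<delta>\<^sub>0 \<delta>\<^sub>A \<nu> X \<phi>"
proof -
  define k where "k = ln (v_par p s2 t2 \<delta>\<^sub>0 \<delta>\<^sub>A)"
  note [measurable] = measurable_decision[OF \<phi>]
  have "\<delta>\<^sub>A * p * (1 - chisq_tail (k / (1 + u_par s2 t2)))
    \<le> \<delta>\<^sub>0 * prob {\<omega> \<in> space M. \<nu> i \<omega> = 0 \<and> \<phi> (obs \<omega>) i}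
      + \<delta>\<^sub>A * prob {\<omega> \<in> space M. \<nu> i \<omega> = 1 \<and> \<not> \<phi> (obs \<omega>) i}" if i: "i \<in> {1..m}" for i
  proof -
    note [measurable] = i
    \<comment> \<open>The observation vectors for which the rule rejects although accepting would be no worse.\<close>
    let ?S = "{x \<in> space (PiM {1..m} (\<lambda>_. borel)). \<phi> x i} \<inter> {x \<in> space (PiM {1..m} (\<lambda>_. borel)). (x i)\<^sup>2 / s2 < k}"
    have S: "?S \<in> sets (PiM {1..m} (\<lambda>_. borel))"
      using measurable_rule[OF \<phi> i] by (rule sets.Int) measurable
    have obs_S: "obs \<omega> \<in> ?S \<longleftrightarrow> \<phi> (obs \<omega>) i \<and> (X i \<omega>)\<^sup>2 / s2 < k" for \<omega>
      using i obs_in_space by (simp add: obs_def)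
    have "\<delta>\<^sub>A * p * (1 - chisq_tail (k / (1 + u_par s2 t2)))
        = \<delta>\<^sub>A * prob {\<omega> \<in> space M. \<nu> i \<omega> = 1 \<and> (X i \<omega>)\<^sup>2 / s2 < k}"
      by (subst prob_alt_below[OF i]) (simp only: mult.assoc)
    also have "\<dots> \<le> \<delta>\<^sub>A * (prob {\<omega> \<in> space M. \<nu> i \<omega> = 1 \<and> obs \<omega> \<in> ?S}
        + prob {\<omega> \<in> space M. \<nu> i \<omega> = 1 \<and> \<not> \<phi> (obs \<omega>) i})"
    proof (rule mult_left_mono)
      have "prob {\<omega> \<in> space M. \<nu> i \<omega> = 1 \<and> (X i \<omega>)\<^sup>2 / s2 < k}
        \<le> prob ({\<omega> \<in> space M. \<nu> i \<omega> = 1 \<and> obs \<omega> \<in> ?S} \<union> {\<omega> \<in> space M. \<nu> i \<omega> = 1 \<and> \<not> \<phi> (obs \<omega>) i})"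
        unfolding obs_S by (intro finite_measure_mono) auto
      also have "\<dots> \<le> prob {\<omega> \<in> space M. \<nu> i \<omega> = 1 \<and> obs \<omega> \<in> ?S}
        + prob {\<omega> \<in> space M. \<nu> i \<omega> = 1 \<and> \<not> \<phi> (obs \<omega>) i}"
        unfolding obs_S using i by (intro measure_Un_le) auto
      finally show "prob {\<omega> \<in> space M. \<nu> i \<omega> = 1 \<and> (X i \<omega>)\<^sup>2 / s2 < k} \<le> \<dots>" .
    qed (use \<delta> in simp)
    also have "\<delta>\<^sub>A * prob {\<omega> \<in> space M. \<nu> i \<omega> = 1 \<and> obs \<omega> \<in> ?S}
        \<le> \<delta>\<^sub>0 * prob {\<omega> \<in> space M. \<nu> i \<omega> = 0 \<and> obs \<omega> \<in> ?S}"
      using alt_density_le_null_density[OF \<delta>] by (intro cost_alt_le_null[OF i S \<delta>]) (auto simp: k_def)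
    then have "\<delta>\<^sub>A * (prob {\<omega> \<in> space M. \<nu> i \<omega> = 1 \<and> obs \<omega> \<in> ?S}
        + prob {\<omega> \<in> space M. \<nu> i \<omega> = 1 \<and> \<not> \<phi> (obs \<omega>) i})
      \<le> \<delta>\<^sub>0 * prob {\<omega> \<in> space M. \<nu> i \<omega> = 0 \<and> obs \<omega> \<in> ?S}
        + \<delta>\<^sub>A * prob {\<omega> \<in> space M. \<nu> i \<omega> = 1 \<and> \<not> \<phi> (obs \<omega>) i}"
      by (simp add: distrib_left)
    also have "\<delta>\<^sub>0 * prob {\<omega> \<in> space M. \<nu> i \<omega> = 0 \<and> obs \<omega> \<in> ?S}
        \<le> \<delta>\<^sub>0 * prob {\<omega> \<in> space M. \<nu> i \<omega> = 0 \<and> \<phi> (obs \<omega>) i}"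
      unfolding obs_S using \<delta> by (intro mult_left_mono finite_measure_mono) auto
    finally show ?thesis by simp
  qed
  then have "(\<Sum>i=1..m. \<delta>\<^sub>A * p * (1 - chisq_tail (k / (1 + u_par s2 t2)))) \<le> bayes_risk M m \<delta>\<^sub>0 \<delta>\<^sub>A \<nu> X \<phi>"
    unfolding bayes_risk_eq_sum[OF \<phi>] by (rule sum_mono)
  then show ?thesis by (simp add: k_def)
qed

lemma optimal_risk_bounds:
  assumes \<delta>: "\<delta>\<^sub>0 > 0" "\<delta>\<^sub>A > 0"
  shows "real m * (\<delta>\<^sub>A * p * (1 - chisq_tail (ln (v_par p s2 t2 \<delta>\<^sub>0 \<delta>\<^sub>A) / (1 + u_par s2 t2))))
      \<le> optimal_risk M m \<delta>\<^sub>0 \<delta>\<^sub>A \<nu> X"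
    and "optimal_risk M m \<delta>\<^sub>0 \<delta>\<^sub>A \<nu> X \<le> bayes_risk M m \<delta>\<^sub>0 \<delta>\<^sub>A \<nu> X (threshold_rule s2 k)"
  unfolding optimal_risk_def
  using threshold_rule_in_testing_rules bayes_risk_ge[OF _ \<delta>]
  by (auto intro!: cINF_greatest cINF_lower bdd_belowI2)

end

section \<open>The two components of the normalized risk\<close>

text \<open>
  The type I part and the type II part of the risk of the rule with threshold \<open>a\<close>, per test and in units
  of \<open>p \<delta>\<^sub>A\<close>. In both, \<open>u\<close> stands for \<open>\<tau>\<^sup>2 / \<sigma>\<^sup>2\<close>, and \<open>L\<close> for \<open>log v\<close>, so that the factor
  \<open>exp (L / 2) / \<surd>u\<close> is \<open>\<surd>(v / u)\<close>, the ratio of \<open>\<delta>\<^sub>0 (1 - p)\<close> and \<open>\<delta>\<^sub>A p\<close>.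
\<close>

definition null_risk :: "real \<Rightarrow> real \<Rightarrow> real \<Rightarrow> real" where
  "null_risk L u a = exp (L / 2) / sqrt u * chisq_tail a"

definition alt_risk :: "real \<Rightarrow> real \<Rightarrow> real" where
  "alt_risk u a = 1 - chisq_tail (a / (1 + u))"

lemma null_risk_nonneg: "0 < u \<Longrightarrow> 0 \<le> null_risk L u a"
  by (simp add: null_risk_def chisq_tail_nonneg)

lemma alt_risk_nonneg: "0 \<le> alt_risk u a"
  by (simp add: alt_risk_def chisq_tail_le_1)

lemma (in two_groups_model) bayes_risk_threshold_normalized:
  assumes \<delta>: "\<delta>\<^sub>0 > 0" "\<delta>\<^sub>A > 0"
  shows "bayes_risk M m \<delta>\<^sub>0 \<delta>\<^sub>A \<nu> X (threshold_rule s2 k) = real m * \<delta>\<^sub>A * p *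
    (null_risk (ln (v_par p s2 t2 \<delta>\<^sub>0 \<delta>\<^sub>A)) (u_par s2 t2) k + alt_risk (u_par s2 t2) k)"
proof -
  define r where "r = \<delta>\<^sub>0 * (1 - p) / (\<delta>\<^sub>A * p)"
  define v where "v = v_par p s2 t2 \<delta>\<^sub>0 \<delta>\<^sub>A"
  have r: "r > 0" using \<delta> p_pos p_less_1 by (simp add: r_def)
  have u: "u_par s2 t2 > 0" using s2_pos t2_pos by (simp add: u_par_def)
  have v_eq: "v = u_par s2 t2 * r\<^sup>2"
    by (simp add: v_def v_par_def r_def power_divide power_mult_distrib mult_ac)
  have v: "v > 0" using r u by (simp add: v_eq)
  have "exp (ln v / 2) = sqrt v" using v by (simp add: powr_half_sqrt[symmetric] powr_def)
  then have "exp (ln v / 2) / sqrt (u_par s2 t2) = r"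
    using r u by (simp add: v_eq real_sqrt_mult)
  then have "\<delta>\<^sub>A * p * null_risk (ln v) (u_par s2 t2) k = \<delta>\<^sub>0 * (1 - p) * chisq_tail k"
    using \<delta> p_pos by (simp add: null_risk_def r_def)
  then show ?thesis
    unfolding bayes_risk_threshold v_def alt_risk_def by (simp only: distrib_left mult.assoc)
qed

lemma (in two_groups_model) optimal_risk_normalized:
  assumes \<delta>: "\<delta>\<^sub>0 > 0" "\<delta>\<^sub>A > 0"
  defines "L \<equiv> ln (v_par p s2 t2 \<delta>\<^sub>0 \<delta>\<^sub>A)"
  shows "alt_risk (u_par s2 t2) L \<le> optimal_risk M m \<delta>\<^sub>0 \<delta>\<^sub>A \<nu> X / (real m * \<delta>\<^sub>A * p)"
    and "optimal_risk M m \<delta>\<^sub>0 \<delta>\<^sub>A \<nu> X / (real m * \<delta>\<^sub>A * p) \<le> null_risk L (u_par s2 t2) L + alt_risk (u_par s2 t2) L"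
proof -
  have "0 < real m * \<delta>\<^sub>A * p" using m_pos \<delta> p_pos by simp
  then show "alt_risk (u_par s2 t2) L \<le> optimal_risk M m \<delta>\<^sub>0 \<delta>\<^sub>A \<nu> X / (real m * \<delta>\<^sub>A * p)"
    and "optimal_risk M m \<delta>\<^sub>0 \<delta>\<^sub>A \<nu> X / (real m * \<delta>\<^sub>A * p) \<le> null_risk L (u_par s2 t2) L + alt_risk (u_par s2 t2) L"
    using optimal_risk_bounds(1)[OF \<delta>] optimal_risk_bounds(2)[OF \<delta>, of L]
    unfolding bayes_risk_threshold_normalized[OF \<delta>] L_def
    by (simp_all add: pos_le_divide_eq pos_divide_le_eq alt_risk_def mult_ac)
qed

section \<open>Asymptotics of the normalized risk\<close>

text \<open>
  The type I part is of the order \<open>exp (- (z + 2 log L) / 2)\<close>, up to the two square roots, which stay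
  bounded and bounded away from \<open>0\<close> in the regime of interest.
\<close>

lemma null_risk_bounds:
  fixes L u z :: real
  assumes "0 < L" "0 < u" "1 \<le> L + z"
  defines "W \<equiv> exp (- (z + 2 * ln L) / 2) * (sqrt (L / u) * sqrt (L / (L + z)))"
  shows "exp (- 2) / sqrt (2 * pi) * W \<le> null_risk L u (L + z)"
    and "null_risk L u (L + z) \<le> 2 / sqrt (2 * pi) * W"
proof -
  let ?e = "exp (- (L + z) / 2) / sqrt (L + z)"
  have "exp (- (z + 2 * ln L) / 2) = exp (- z / 2) / L"
    using assms(1) by (simp add: add_divide_distrib diff_divide_distrib exp_diff)
  moreover have "sqrt (L / u) * sqrt (L / (L + z)) = L / (sqrt u * sqrt (L + z))"
    using assms by (simp add: real_sqrt_divide)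
  moreover have "exp (L / 2) * exp (- (L + z) / 2) = exp (- z / 2)"
    by (simp add: exp_add[symmetric] add_divide_distrib diff_divide_distrib)
  ultimately have W: "W = exp (L / 2) / sqrt u * ?e"
    using assms(1) unfolding W_def by simp
  have "exp (L / 2) / sqrt u * (exp (- 2) / sqrt (2 * pi) * ?e) \<le> null_risk L u (L + z)"
    unfolding null_risk_def using assms by (intro mult_left_mono chisq_tail_ge) auto
  then show "exp (- 2) / sqrt (2 * pi) * W \<le> null_risk L u (L + z)"
    unfolding W by (simp only: mult_ac)
  have "null_risk L u (L + z) \<le> exp (L / 2) / sqrt u * (2 / sqrt (2 * pi) * ?e)"
    unfolding null_risk_def using assms by (intro mult_left_mono chisq_tail_le) auto
  then show "null_risk L u (L + z) \<le> 2 / sqrt (2 * pi) * W"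
    unfolding W by (simp only: mult_ac)
qed

text \<open>
  Here \<open>L\<close>, in the role of \<open>log v\<close>, and \<open>u\<close> are any two sequences with the limits assumed of them.
\<close>

context
  fixes L u :: "nat \<Rightarrow> real" and C :: real
  assumes L: "filterlim L at_top sequentially" and u: "filterlim u at_top sequentially"
    and C: "(\<lambda>t. L t / u t) \<longlonglongrightarrow> C" "0 < C"
begin

lemma eventually_L_pos: "eventually (\<lambda>t. 0 < L t) sequentially"
  and eventually_u_pos: "eventually (\<lambda>t. 0 < u t) sequentially"
  using L u by (auto simp: filterlim_at_top_dense)

lemma scaled_threshold_tendsto:
  assumes "(\<lambda>t. z t / L t) \<longlonglongrightarrow> \<zeta>"
  shows "(\<lambda>t. (L t + z t) / (1 + u t)) \<longlonglongrightarrow> C * (1 + \<zeta>)"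
proof -
  have "((\<lambda>x. x / (1 + x)) \<longlongrightarrow> (1::real)) at_top" by real_asymp
  from filterlim_compose[OF this u]
  have "(\<lambda>t. L t / u t * (1 + z t / L t) * (u t / (1 + u t))) \<longlonglongrightarrow> C * (1 + \<zeta>) * 1"
    by (intro tendsto_intros C(1) assms)
  moreover have "eventually (\<lambda>t. L t / u t * (1 + z t / L t) * (u t / (1 + u t)) = (L t + z t) / (1 + u t)) sequentially"
    using eventually_L_pos eventually_u_pos
  proof eventually_elim
    case (elim t)
    then have "L t * (1 + z t / L t) = L t + z t" by (simp add: distrib_left)
    moreover have "L t / u t * (1 + z t / L t) * (u t / (1 + u t)) = L t * (1 + z t / L t) / (1 + u t)"
      using elim by simp
    ultimately show ?case by simp
  qed
  ultimately have "(\<lambda>t. (L t + z t) / (1 + u t)) \<longlonglongrightarrow> C * (1 + \<zeta>) * 1"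
    by (rule Lim_transform_eventually)
  then show ?thesis by simp
qed

lemma alt_risk_tendsto:
  assumes "(\<lambda>t. z t / L t) \<longlonglongrightarrow> \<zeta>" "-1 < \<zeta>"
  shows "(\<lambda>t. alt_risk (u t) (L t + z t)) \<longlonglongrightarrow> 1 - chisq_tail (C * (1 + \<zeta>))"
  unfolding alt_risk_def using assms C(2)
  by (intro tendsto_intros chisq_tail_tendsto scaled_threshold_tendsto) auto

lemma threshold_at_top:
  assumes "(\<lambda>t. z t / L t) \<longlonglongrightarrow> \<zeta>" "-1 < \<zeta>"
  shows "filterlim (\<lambda>t. L t + z t) at_top sequentially"
proof -
  have "(\<lambda>t. 1 + z t / L t) \<longlonglongrightarrow> 1 + \<zeta>"
    by (intro tendsto_intros assms)
  from filterlim_tendsto_pos_mult_at_top[OF this _ L]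
  have "filterlim (\<lambda>t. (1 + z t / L t) * L t) at_top sequentially"
    using assms(2) by simp
  moreover have "eventually (\<lambda>t. (1 + z t / L t) * L t = L t + z t) sequentially"
    using eventually_L_pos by eventually_elim (simp add: field_simps)
  ultimately show ?thesis by (simp add: filterlim_cong)
qed

lemma null_risk_tendsto_0_iff:
  assumes z: "(\<lambda>t. z t / L t) \<longlonglongrightarrow> 0"
  shows "(\<lambda>t. null_risk (L t) (u t) (L t + z t)) \<longlonglongrightarrow> 0 \<longleftrightarrow>
    filterlim (\<lambda>t. z t + 2 * ln (L t)) at_top sequentially"
proof -
  define E where "E t = exp (- (z t + 2 * ln (L t)) / 2)" for t
  define k :: real where "k = exp (- 2) / sqrt (2 * pi)"
  have k: "0 < k" by (simp add: k_def)
  define s where "s t = sqrt (L t / u t) * sqrt (L t / (L t + z t))" for t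
  have "(\<lambda>t. sqrt (L t / u t) * sqrt (1 / (1 + z t / L t))) \<longlonglongrightarrow> sqrt C * sqrt (1 / (1 + 0))"
    by (intro tendsto_intros C(1) z) simp
  moreover have "eventually (\<lambda>t. sqrt (L t / u t) * sqrt (1 / (1 + z t / L t)) = s t) sequentially"
    using eventually_L_pos by eventually_elim (simp add: s_def field_simps)
  ultimately have s: "s \<longlonglongrightarrow> sqrt C" by (simp add: tendsto_cong)
  have "eventually (\<lambda>t. 1 \<le> L t + z t) sequentially"
    using threshold_at_top[OF z] by (simp add: filterlim_at_top)
  then have bounds: "eventually (\<lambda>t. k * (E t * s t) \<le> null_risk (L t) (u t) (L t + z t)
      \<and> null_risk (L t) (u t) (L t + z t) \<le> 2 / sqrt (2 * pi) * (E t * s t) \<and> 0 < s t) sequentially"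
    using eventually_L_pos eventually_u_pos
    unfolding E_def s_def k_def by eventually_elim (intro conjI null_risk_bounds, auto)
  show ?thesis
  proof
    assume null: "(\<lambda>t. null_risk (L t) (u t) (L t + z t)) \<longlonglongrightarrow> 0"
    have lim: "(\<lambda>t. null_risk (L t) (u t) (L t + z t) / k / s t)
        \<longlonglongrightarrow> 0 / k / sqrt C"
      using C(2) k by (intro tendsto_intros null s) auto
    have "E \<longlonglongrightarrow> 0"
    proof (rule tendsto_sandwich[where f = "\<lambda>_. 0"])
      show "eventually (\<lambda>t. E t \<le> null_risk (L t) (u t) (L t + z t) / k / s t) sequentially"
        using bounds by eventually_elim (simp add: pos_le_divide_eq k mult_ac del: divide_divide_eq_left)
      show "(\<lambda>t. null_risk (L t) (u t) (L t + z t) / k / s t) \<longlonglongrightarrow> 0"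
        using lim by simp
    qed (auto simp: E_def)
    show "filterlim (\<lambda>t. z t + 2 * ln (L t)) at_top sequentially"
      unfolding filterlim_at_top
    proof
      fix K :: real
      have "eventually (\<lambda>t. E t < exp (- K / 2)) sequentially"
        using \<open>E \<longlonglongrightarrow> 0\<close> by (rule order_tendstoD) simp
      then show "eventually (\<lambda>t. K \<le> z t + 2 * ln (L t)) sequentially"
        by eventually_elim (simp add: E_def)
    qed
  next
    assume y: "filterlim (\<lambda>t. z t + 2 * ln (L t)) at_top sequentially"
    have "((\<lambda>x. exp (- x / 2)) \<longlongrightarrow> (0::real)) at_top" by real_asymp
    from filterlim_compose[OF this y] have "E \<longlonglongrightarrow> 0" by (simp add: E_def[abs_def])
    have lim: "(\<lambda>t. 2 / sqrt (2 * pi) * (E t * s t)) \<longlonglongrightarrow> 2 / sqrt (2 * pi) * (0 * sqrt C)"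
      by (intro tendsto_intros \<open>E \<longlonglongrightarrow> 0\<close> s)
    show "(\<lambda>t. null_risk (L t) (u t) (L t + z t)) \<longlonglongrightarrow> 0"
    proof (rule tendsto_sandwich)
      show "eventually (\<lambda>t. 0 \<le> null_risk (L t) (u t) (L t + z t)) sequentially"
        using eventually_u_pos by eventually_elim (rule null_risk_nonneg)
      show "eventually (\<lambda>t. null_risk (L t) (u t) (L t + z t) \<le> 2 / sqrt (2 * pi) * (E t * s t)) sequentially"
        using bounds by eventually_elim simp
      show "(\<lambda>t. 2 / sqrt (2 * pi) * (E t * s t)) \<longlonglongrightarrow> 0" using lim by simp
    qed simp
  qed
qed

text \<open>
  A threshold smaller than \<open>log v\<close> by a fixed factor makes the type I part explode.
\<close>

lemma null_risk_at_top:
  assumes \<epsilon>: "0 < \<epsilon>" "\<epsilon> < 1"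
  shows "filterlim (\<lambda>t. null_risk (L t) (u t) ((1 - \<epsilon>) * L t)) at_top sequentially"
proof -
  define k where "k = exp (- 2) / sqrt (2 * pi) * (sqrt C * sqrt (1 / (1 - \<epsilon>)))"
  have k: "0 < k" using \<epsilon> C(2) by (simp add: k_def)
  have "filterlim (\<lambda>x. exp (\<epsilon> * x / 2) / x) at_top at_top" using \<epsilon>(1) by real_asymp
  from filterlim_compose[OF this L]
  have E: "filterlim (\<lambda>t. exp (\<epsilon> * L t / 2) / L t) at_top sequentially" .
  have "(\<lambda>t. exp (- 2) / sqrt (2 * pi) * (sqrt (L t / u t) * sqrt (1 / (1 - \<epsilon>)))) \<longlonglongrightarrow> k"
    unfolding k_def by (intro tendsto_intros C(1))
  from filterlim_tendsto_pos_mult_at_top[OF this k E]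
  have top: "filterlim (\<lambda>t. exp (- 2) / sqrt (2 * pi) * (sqrt (L t / u t) * sqrt (1 / (1 - \<epsilon>))) * (exp (\<epsilon> * L t / 2) / L t))
      at_top sequentially" .
  have "eventually (\<lambda>t. 1 / (1 - \<epsilon>) \<le> L t) sequentially"
    using L by (simp add: filterlim_at_top)
  then have "eventually (\<lambda>t. exp (- 2) / sqrt (2 * pi) * (sqrt (L t / u t) * sqrt (1 / (1 - \<epsilon>))) * (exp (\<epsilon> * L t / 2) / L t)
      \<le> null_risk (L t) (u t) ((1 - \<epsilon>) * L t)) sequentially"
    using eventually_L_pos eventually_u_pos
  proof eventually_elim
    case (elim t)
    \<comment> \<open>The general lower bound, with the offset \<open>- \<epsilon> L\<close>.\<close>
    have eq: "L t + - \<epsilon> * L t = (1 - \<epsilon>) * L t" by (simp add: algebra_simps)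
    have "1 \<le> L t + - \<epsilon> * L t" unfolding eq using elim \<epsilon> by (simp add: field_simps)
    note null_risk_bounds(1)[OF elim(2,3) this]
    moreover have "L t / (L t + - \<epsilon> * L t) = 1 / (1 - \<epsilon>)"
      unfolding eq using elim \<epsilon> by simp
    moreover have "exp (- (- \<epsilon> * L t + 2 * ln (L t)) / 2) = exp (\<epsilon> * L t / 2) / L t"
      using elim by (simp add: diff_divide_distrib exp_diff)
    ultimately show ?case unfolding eq by (simp only: mult_ac)
  qed
  then show ?thesis by (rule filterlim_at_top_mono[OF top])
qed

text \<open>
  The necessity of \<open>z = o(log v)\<close>: thresholds that are too large are excluded by the type II part, those
  that are too small by the type I part.
\<close>

lemma risk_limit_imp_offset_negligible:
  assumes lim: "(\<lambda>t. null_risk (L t) (u t) (L t + z t) + alt_risk (u t) (L t + z t)) \<longlonglongrightarrow> 1 - chisq_tail C"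
  shows "(\<lambda>t. z t / L t) \<longlonglongrightarrow> 0"
proof (rule order_tendstoI)
  fix \<epsilon>' :: real
  assume "\<epsilon>' < 0"
  define \<epsilon> where "\<epsilon> = min (1 / 2) (- \<epsilon>')"
  have \<epsilon>: "0 < \<epsilon>" "\<epsilon> < 1" "\<epsilon>' \<le> - \<epsilon>" using \<open>\<epsilon>' < 0\<close> by (auto simp: \<epsilon>_def)
  \<comment> \<open>Any bound above the limit \<open>1 - chisq_tail C \<le> 1\<close> serves.\<close>
  have "eventually (\<lambda>t. 2 \<le> null_risk (L t) (u t) ((1 - \<epsilon>) * L t)) sequentially"
    using null_risk_at_top[OF \<epsilon>(1,2)] by (simp add: filterlim_at_top)
  moreover have "eventually (\<lambda>t. null_risk (L t) (u t) (L t + z t) + alt_risk (u t) (L t + z t) < 2) sequentially"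
    using lim by (rule order_tendstoD) (use chisq_tail_nonneg[of C] in simp)
  ultimately show "eventually (\<lambda>t. \<epsilon>' < z t / L t) sequentially"
    using eventually_L_pos eventually_u_pos
  proof eventually_elim
    case (elim t)
    show ?case
    proof (rule ccontr)
      assume "\<not> \<epsilon>' < z t / L t"
      then have "z t / L t \<le> - \<epsilon>" using \<epsilon>(3) by linarith
      then have "L t + z t \<le> (1 - \<epsilon>) * L t" using elim by (simp add: field_simps)
      then have "null_risk (L t) (u t) ((1 - \<epsilon>) * L t) \<le> null_risk (L t) (u t) (L t + z t)"
        unfolding null_risk_def using elim by (intro mult_left_mono chisq_tail_antimono) auto
      then show False using elim alt_risk_nonneg[of "u t" "L t + z t"] by linarith
    qed
  qed
next
  fix \<epsilon> :: real
  assume \<epsilon>: "0 < \<epsilon>"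
  have "(\<lambda>t. \<epsilon> * L t / L t) \<longlonglongrightarrow> \<epsilon>"
    by (rule Lim_transform_eventually[OF tendsto_const]) (rule eventually_mono[OF eventually_L_pos], simp)
  from alt_risk_tendsto[OF this] \<epsilon>
  have alt: "(\<lambda>t. alt_risk (u t) (L t + \<epsilon> * L t)) \<longlonglongrightarrow> 1 - chisq_tail (C * (1 + \<epsilon>))" by simp
  have "chisq_tail (C * (1 + \<epsilon>)) < chisq_tail C"
    using C(2) \<epsilon> by (intro chisq_tail_strict_antimono) auto
  then obtain b where b: "1 - chisq_tail C < b" "b < 1 - chisq_tail (C * (1 + \<epsilon>))"
    using dense[of "1 - chisq_tail C" "1 - chisq_tail (C * (1 + \<epsilon>))"] by auto
  show "eventually (\<lambda>t. z t / L t < \<epsilon>) sequentially"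
    using order_tendstoD(1)[OF alt b(2)] order_tendstoD(2)[OF lim b(1)] eventually_L_pos eventually_u_pos
  proof eventually_elim
    case (elim t)
    show ?case
    proof (rule ccontr)
      assume "\<not> z t / L t < \<epsilon>"
      then have "L t + \<epsilon> * L t \<le> L t + z t" using elim by (simp add: field_simps)
      then have "alt_risk (u t) (L t + \<epsilon> * L t) \<le> alt_risk (u t) (L t + z t)"
        unfolding alt_risk_def using elim
        by (intro diff_left_mono chisq_tail_antimono divide_right_mono) auto
      then show False using elim null_risk_nonneg[of "u t" "L t" "L t + z t"] by linarith
    qed
  qed
qed

lemma risk_limit_iff:
  "(\<lambda>t. null_risk (L t) (u t) (L t + z t) + alt_risk (u t) (L t + z t)) \<longlonglongrightarrow> 1 - chisq_tail C \<longleftrightarrow>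
    (\<lambda>t. z t / L t) \<longlonglongrightarrow> 0 \<and> filterlim (\<lambda>t. z t + 2 * ln (L t)) at_top sequentially"
proof
  assume lim: "(\<lambda>t. null_risk (L t) (u t) (L t + z t) + alt_risk (u t) (L t + z t)) \<longlonglongrightarrow> 1 - chisq_tail C"
  note z = risk_limit_imp_offset_negligible[OF lim]
  have "(\<lambda>t. alt_risk (u t) (L t + z t)) \<longlonglongrightarrow> 1 - chisq_tail C"
    using alt_risk_tendsto[OF z] by simp
  from tendsto_diff[OF lim this] have "(\<lambda>t. null_risk (L t) (u t) (L t + z t)) \<longlonglongrightarrow> 0" by simp
  with z show "(\<lambda>t. z t / L t) \<longlonglongrightarrow> 0 \<and> filterlim (\<lambda>t. z t + 2 * ln (L t)) at_top sequentially"
    by (simp add: null_risk_tendsto_0_iff)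
next
  assume "(\<lambda>t. z t / L t) \<longlonglongrightarrow> 0 \<and> filterlim (\<lambda>t. z t + 2 * ln (L t)) at_top sequentially"
  then show "(\<lambda>t. null_risk (L t) (u t) (L t + z t) + alt_risk (u t) (L t + z t)) \<longlonglongrightarrow> 1 - chisq_tail C"
    using tendsto_add[of "\<lambda>t. null_risk (L t) (u t) (L t + z t)" 0] alt_risk_tendsto[of z 0]
    by (fastforce simp: null_risk_tendsto_0_iff)
qed

end

section \<open>Asymptotic Bayes optimality\<close>

theorem theorem3p2:
  fixes M :: "nat \<Rightarrow> 'a measure" and m :: "nat \<Rightarrow> nat"
    and p s2 t2 \<delta>\<^sub>0 \<delta>\<^sub>A u v c z :: "nat \<Rightarrow> real"
    and \<nu> :: "nat \<Rightarrow> nat \<Rightarrow> 'a \<Rightarrow> nat" and X :: "nat \<Rightarrow> nat \<Rightarrow> 'a \<Rightarrow> real" and C :: real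
  assumes model: "\<And>t. two_groups_model (M t) (m t) (p t) (s2 t) (t2 t) (\<nu> t) (X t)"
    and losses: "\<And>t. \<delta>\<^sub>0 t > 0" "\<And>t. \<delta>\<^sub>A t > 0"
    and u: "\<And>t. u t = u_par (s2 t) (t2 t)"
    and v: "\<And>t. v t = v_par (p t) (s2 t) (t2 t) (\<delta>\<^sub>0 t) (\<delta>\<^sub>A t)"
    and p_lim: "p \<longlonglongrightarrow> 0"
    and u_lim: "filterlim u at_top sequentially"
    and v_lim: "filterlim v at_top sequentially"
    and C_lim: "(\<lambda>t. ln (v t) / u t) \<longlonglongrightarrow> C" and C_pos: "C > 0"
    and c: "\<And>t. (c t)\<^sup>2 = ln (v t) + z t"
  shows "ABOS M m \<delta>\<^sub>0 \<delta>\<^sub>A \<nu> X (\<lambda>t. threshold_rule (s2 t) ((c t)\<^sup>2)) \<longleftrightarrow>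
    z \<in> o(\<lambda>t. ln (v t)) \<and>
    filterlim (\<lambda>t. z t + 2 * ln (ln (v t))) at_top sequentially"
proof -
  define L where "L t = ln (v t)" for t
  \<comment> \<open>The normalized risks of the given rule and of the oracle.\<close>
  define \<rho> where "\<rho> t = null_risk (L t) (u t) (L t + z t) + alt_risk (u t) (L t + z t)" for t
  define \<omega> where "\<omega> t = optimal_risk (M t) (m t) (\<delta>\<^sub>0 t) (\<delta>\<^sub>A t) (\<nu> t) (X t) / (real (m t) * \<delta>\<^sub>A t * p t)" for t
  define B where "B = 1 - chisq_tail C"
  have L_lim: "filterlim L at_top sequentially"
    unfolding L_def using filterlim_compose[OF ln_at_top v_lim] .
  note asymp = L_lim u_lim C_lim[folded L_def] C_pos
  have B: "0 < B"
    unfolding B_def using chisq_tail_strict_antimono[of 0 C] C_pos by (simp add: chisq_tail_zero)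
  have scale: "real (m t) * \<delta>\<^sub>A t * p t \<noteq> 0" for t
    using two_groups_model.m_pos[OF model, of t] two_groups_model.p_pos[OF model, of t] losses(2)[of t] by simp
  have "bayes_risk (M t) (m t) (\<delta>\<^sub>0 t) (\<delta>\<^sub>A t) (\<nu> t) (X t) (threshold_rule (s2 t) ((c t)\<^sup>2))
      = real (m t) * \<delta>\<^sub>A t * p t * \<rho> t" for t
    using two_groups_model.bayes_risk_threshold_normalized[OF model[of t] losses[of t], where k = "(c t)\<^sup>2"]
    by (simp add: \<rho>_def L_def u v c)
  then have ratio: "bayes_risk (M t) (m t) (\<delta>\<^sub>0 t) (\<delta>\<^sub>A t) (\<nu> t) (X t) (threshold_rule (s2 t) ((c t)\<^sup>2))
      / optimal_risk (M t) (m t) (\<delta>\<^sub>0 t) (\<delta>\<^sub>A t) (\<nu> t) (X t) = \<rho> t / \<omega> t" for t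
    using scale[of t] by (simp add: \<omega>_def field_simps)
  \<comment> \<open>The threshold \<open>log v\<close>, which has offset \<open>0\<close>, is near optimal.\<close>
  have "filterlim (\<lambda>t. 0 + 2 * ln (L t)) at_top sequentially"
  proof -
    have "filterlim (\<lambda>x. 0 + 2 * ln x) at_top (at_top :: real filter)" by real_asymp
    from filterlim_compose[OF this L_lim] show ?thesis .
  qed
  then have upper: "(\<lambda>t. null_risk (L t) (u t) (L t) + alt_risk (u t) (L t)) \<longlonglongrightarrow> B"
    using risk_limit_iff[OF asymp, of "\<lambda>_. 0"] by (simp add: B_def)
  have lower: "(\<lambda>t. alt_risk (u t) (L t)) \<longlonglongrightarrow> B"
    using alt_risk_tendsto[OF asymp, of "\<lambda>_. 0" 0] by (simp add: B_def)
  have \<omega>: "\<omega> \<longlonglongrightarrow> B"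
    by (rule tendsto_sandwich[OF _ _ lower upper])
      (use two_groups_model.optimal_risk_normalized[OF model losses] in
        \<open>auto simp: \<omega>_def L_def u v\<close>)
  have "ABOS M m \<delta>\<^sub>0 \<delta>\<^sub>A \<nu> X (\<lambda>t. threshold_rule (s2 t) ((c t)\<^sup>2)) \<longleftrightarrow> (\<lambda>t. \<rho> t / \<omega> t) \<longlonglongrightarrow> 1"
    by (simp add: ABOS_def ratio)
  also have "\<dots> \<longleftrightarrow> \<rho> \<longlonglongrightarrow> B"
  proof
    assume "(\<lambda>t. \<rho> t / \<omega> t) \<longlonglongrightarrow> 1"
    from tendsto_mult[OF this \<omega>] have "(\<lambda>t. \<rho> t / \<omega> t * \<omega> t) \<longlonglongrightarrow> B" by simp
    moreover have "eventually (\<lambda>t. \<rho> t / \<omega> t * \<omega> t = \<rho> t) sequentially"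
      using order_tendstoD(1)[OF \<omega> B] by eventually_elim simp
    ultimately show "\<rho> \<longlonglongrightarrow> B" by (simp add: tendsto_cong)
  next
    assume "\<rho> \<longlonglongrightarrow> B"
    from tendsto_divide[OF this \<omega>] B show "(\<lambda>t. \<rho> t / \<omega> t) \<longlonglongrightarrow> 1" by simp
  qed
  also have "\<dots> \<longleftrightarrow> (\<lambda>t. z t / L t) \<longlonglongrightarrow> 0 \<and> filterlim (\<lambda>t. z t + 2 * ln (L t)) at_top sequentially"
    unfolding \<rho>_def[abs_def] B_def by (rule risk_limit_iff[OF asymp])
  also have "(\<lambda>t. z t / L t) \<longlonglongrightarrow> 0 \<longleftrightarrow> z \<in> o(L)"
  proof
    have "eventually (\<lambda>t. L t \<noteq> 0) sequentially"
      using eventually_L_pos[OF asymp] by eventually_elim simp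
    then show "(\<lambda>t. z t / L t) \<longlonglongrightarrow> 0 \<Longrightarrow> z \<in> o(L)"
      by (intro smalloI_tendsto)
    show "z \<in> o(L) \<Longrightarrow> (\<lambda>t. z t / L t) \<longlonglongrightarrow> 0"
      by (rule smalloD_tendsto)
  qed
  finally show ?thesis by (simp add: L_def[abs_def])
qed

end
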